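(* Let $U=(u_{ij})\in\mathbb{R}^{m_X\times m_Y}$ be the payoff matrix of a two-player zero-sum game, and let $(x^*,y^* )\in\Delta^{m_X-1}\times\Delta^{m_Y-1}$ be a Nash equilibrium. Let $X=(x_{i|j})$ be a reactive strategy with all $x_{i|j}>0$. If the $m_Y\times m_Y$ matrix $X^{\mathrm T}U$ is positive definite for zero-sum vectors, then for every $y\in\Delta^{m_Y-1}$ with all $y_j>0$ and $\mathrm{d}y:=y-y^*\neq 0$, the time derivative at $(X,y)$ of the conditional-sum divergence $D$ along the replicator dynamics with memory asymmetry satisfies $$D^{\dagger}(X;\mathrm{d}y):=\dot D(X,y)<0 .$$
   Context: $\Delta^{m-1}$ is the simplex of probability vectors in $\mathbb{R}^m$. Player X has actions $1,\dots,m_X$, player Y has actions $1,\dots,m_Y$; when X plays $i$ and Y plays $j$, X receives $u_{ij}$ and Y receives $-u_{ij}$. A Nash equilibrium is a pair $(x^*,y^* )$ such that $x^*$ maximizes $x\mapsto x^{\mathrm T}Uy^*$ over $\Delta^{m_X-1}$ and $y^*$ minimizes $y\mapsto (x^* )^{\mathrm T}Uy$ over $\Delta^{m_Y-1}$. A reactive strategy of X is an $m_X\times m_Y$ matrix $X=(x_{i|j})$ with nonnegative entries whose columns $x_j=(x_{i|j})_i$ satisfy $\sum_i x_{i|j}=1$ for every $j$ ($x_{i|j}$ is the probability that X plays $i$ when Y's previous action was $j$). Y uses a mixed strategy $y\in\Delta^{m_Y-1}$. X's stationary strategy is $x_i^{\mathrm{st}}=\sum_j x_{i|j}y_j$, and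 X's expected payoff is $$u^{\mathrm{st}}(X,y)=\sum_{i,j}u_{ij}x_i^{\mathrm{st}}y_j=\sum_{i,j,j'}u_{ij'}x_{i|j}y_jy_{j'}.$$ The replicator dynamics with memory asymmetry is the ODE system $$\dot x_{i|j}=x_{i|j}\Big(g_{i|j}-\sum_{i'}x_{i'|j}g_{i'|j}\Big),\qquad \dot y_j=-y_j\Big(h_j-\sum_{j'}y_{j'}h_{j'}\Big),$$ where $g_{i|j}$ and $h_j$ are the partial derivatives of the polynomial $u^{\mathrm{st}}(X,y)$ with respect to $x_{i|j}$ and $y_j$ (all coordinates treated as independent), i.e. $$g_{i|j}=y_j\sum_{j'}u_{ij'}y_{j'},\qquad h_j=\sum_i u_{ij}x_i^{\mathrm{st}}+\sum_i x_{i|j}\sum_{j'}u_{ij'}y_{j'}.$$ The conditional-sum divergence (with respect to $(x^*,y^* )$) is $$D(X,y)=\sum_j D_{\mathrm{KL}}(x^*\|x_j)+D_{\mathrm{KL}}(y^*\|y),\qquad D_{\mathrm{KL}}(p^*\|p)=\sum_k p_k^*\log p_k^*-\sum_k p_k^*\log p_k,$$ with the convention $0\log 0=0$. $\dot D(X,y)$ denotes the derivative of $D$ at the point $(X,y)$ along the replicator dynamics with memory asymmetry, that is, $\dot D(X,y)=\sum_{i,j}\frac{\partial D}{\partial x_{i|j}}\dot x_{i|j}+\sum_j\frac{\partial D}{\partial y_j}\dot y_j$. A real square matrix $M$ (not necessarily symmetric) is positive definite for zero-sum vectors if $\delta^{\mathrm T}M\delta>0$ for all vectors $\delta\neq 0$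 with $\sum_k\delta_k=0$. *)

theory Defs
  imports "HOL-Analysis.Analysis"
begin

text \<open>Actions of X and Y are indexed by the finite types \<open>'m\<close> and \<open>'n\<close>. A matrix \<open>A :: real^'n^'m\<close>
  has entry \<open>A $ i $ j\<close> in row \<open>i\<close> and column \<open>j\<close>; in particular a reactive strategy has
  \<open>X $ i $ j\<close> equal to the probability of playing \<open>i\<close> after Y played \<open>j\<close>.\<close>

definition prob_simplex :: "(real^'k) set" where
  "prob_simplex = {p. (\<forall>k. 0 \<le> p $ k) \<and> (\<Sum>k\<in>UNIV. p $ k) = 1}"

definition nash_equilibrium :: "real^'n^'m \<Rightarrow> real^'m \<Rightarrow> real^'n \<Rightarrow> bool" where
  "nash_equilibrium U xs ys \<longleftrightarrow>
     xs \<in> prob_simplex \<and> ys \<in> prob_simplex \<and>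
     (\<forall>x\<in>prob_simplex. x \<bullet> (U *v ys) \<le> xs \<bullet> (U *v ys)) \<and>
     (\<forall>y\<in>prob_simplex. xs \<bullet> (U *v ys) \<le> xs \<bullet> (U *v y))"

definition reactive_strategy :: "real^'n^'m \<Rightarrow> bool" where
  "reactive_strategy X \<longleftrightarrow> (\<forall>j. column j X \<in> prob_simplex)"

definition stationary_strategy :: "real^'n^'m \<Rightarrow> real^'n \<Rightarrow> real^'m" where
  "stationary_strategy X y = (\<chi> i. \<Sum>j\<in>UNIV. X $ i $ j * y $ j)"

definition stationary_payoff :: "real^'n^'m \<Rightarrow> real^'n^'m \<Rightarrow> real^'n \<Rightarrow> real" where
  "stationary_payoff U X y =
     (\<Sum>i\<in>UNIV. \<Sum>j\<in>UNIV. U $ i $ j * stationary_strategy X y $ i * y $ j)"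

text \<open>With a standard basis vector as \<open>v\<close>, the following are the partial derivatives with all
  coordinates treated as independent (no restriction to the simplex).\<close>

definition dir_deriv :: "('a::real_vector \<Rightarrow> real) \<Rightarrow> 'a \<Rightarrow> 'a \<Rightarrow> real" where
  "dir_deriv f z v = deriv (\<lambda>t. f (z + t *\<^sub>R v)) 0"

definition partial_mat :: "(real^'n^'m \<Rightarrow> real) \<Rightarrow> real^'n^'m \<Rightarrow> 'm \<Rightarrow> 'n \<Rightarrow> real" where
  "partial_mat f X i j = dir_deriv f X (axis i (axis j 1))"

definition partial_vec :: "(real^'n \<Rightarrow> real) \<Rightarrow> real^'n \<Rightarrow> 'n \<Rightarrow> real" where
  "partial_vec f y j = dir_deriv f y (axis j 1)"

definition grad_X :: "real^'n^'m \<Rightarrow> real^'n^'m \<Rightarrow> real^'n \<Rightarrow> 'm \<Rightarrow> 'n \<Rightarrow> real" where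
  "grad_X U X y i j = partial_mat (\<lambda>X'. stationary_payoff U X' y) X i j"

definition grad_Y :: "real^'n^'m \<Rightarrow> real^'n^'m \<Rightarrow> real^'n \<Rightarrow> 'n \<Rightarrow> real" where
  "grad_Y U X y j = partial_vec (\<lambda>y'. stationary_payoff U X y') y j"

lemma grad_X_eq:
  "grad_X U X y i j = y $ j * (\<Sum>j'\<in>UNIV. U $ i $ j' * y $ j')"
proof -
  have "stationary_payoff U (X + t *\<^sub>R axis i (axis j 1)) y =
      stationary_payoff U X y + t * (y $ j * (\<Sum>j'\<in>UNIV. U $ i $ j' * y $ j'))" for t
  proof -
    have 1: "stationary_strategy (X + t *\<^sub>R axis i (axis j 1)) y $ k =
        stationary_strategy X y $ k + (if k = i then t * y $ j else 0)" for k
      by (simp add: stationary_strategy_def axis_def algebra_simps sum.distrib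
          if_distrib[of "\<lambda>a. _ * a"] if_distrib[of "\<lambda>a. a * _"] cong: if_cong)
    have "stationary_payoff U (X + t *\<^sub>R axis i (axis j 1)) y = stationary_payoff U X y +
        (\<Sum>k\<in>UNIV. if k = i then \<Sum>j'\<in>UNIV. U $ k $ j' * (t * y $ j) * y $ j' else 0)"
      unfolding stationary_payoff_def 1 sum.distrib[symmetric]
      by (intro sum.cong refl) (simp add: algebra_simps sum.distrib)
    then show ?thesis
      by (simp add: sum_distrib_left mult_ac)
  qed
  then have "((\<lambda>t. stationary_payoff U (X + t *\<^sub>R axis i (axis j 1)) y) has_real_derivative
      y $ j * (\<Sum>j'\<in>UNIV. U $ i $ j' * y $ j')) (at 0)"
    by (auto intro!: derivative_eq_intros)
  then show ?thesis
    unfolding grad_X_def partial_mat_def dir_deriv_def by (rule DERIV_imp_deriv)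
qed

lemma grad_Y_eq:
  "grad_Y U X y j = (\<Sum>i\<in>UNIV. U $ i $ j * stationary_strategy X y $ i) +
     (\<Sum>i\<in>UNIV. X $ i $ j * (\<Sum>j'\<in>UNIV. U $ i $ j' * y $ j'))"
proof -
  have 1: "stationary_strategy X (y + t *\<^sub>R axis j 1) $ i =
      stationary_strategy X y $ i + t * X $ i $ j" for t i
    by (simp add: stationary_strategy_def axis_def algebra_simps sum.distrib
        if_distrib[of "\<lambda>a. _ * a"] cong: if_cong)
  have 2: "(\<Sum>k\<in>UNIV. U $ i $ k * c * (y + t *\<^sub>R axis j 1) $ k) =
      c * ((\<Sum>k\<in>UNIV. U $ i $ k * y $ k) + t * U $ i $ j)" for i c t
    by (simp add: axis_def algebra_simps sum.distrib sum_distrib_left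
        if_distrib[of "\<lambda>a. _ * a"] cong: if_cong)
  have "((\<lambda>t. stationary_payoff U X (y + t *\<^sub>R axis j 1)) has_real_derivative
      (\<Sum>i\<in>UNIV. U $ i $ j * stationary_strategy X y $ i +
        X $ i $ j * (\<Sum>j'\<in>UNIV. U $ i $ j' * y $ j'))) (at 0)"
    unfolding stationary_payoff_def 1 2
    by (auto intro!: derivative_eq_intros sum.cong simp: algebra_simps)
  then show ?thesis
    unfolding grad_Y_def partial_vec_def dir_deriv_def sum.distrib by (rule DERIV_imp_deriv)
qed

definition replicator_X :: "real^'n^'m \<Rightarrow> real^'n^'m \<Rightarrow> real^'n \<Rightarrow> 'm \<Rightarrow> 'n \<Rightarrow> real" where
  "replicator_X U X y i j =
     X $ i $ j * (grad_X U X y i j - (\<Sum>i'\<in>UNIV. X $ i' $ j * grad_X U X y i' j))"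

definition replicator_Y :: "real^'n^'m \<Rightarrow> real^'n^'m \<Rightarrow> real^'n \<Rightarrow> 'n \<Rightarrow> real" where
  "replicator_Y U X y j =
     - y $ j * (grad_Y U X y j - (\<Sum>j'\<in>UNIV. y $ j' * grad_Y U X y j'))"

text \<open>The convention \<open>0 log 0 = 0\<close> holds automatically. Since \<open>ln 0 = 0\<close>, the value is not the usual
  one (plus infinity) if \<open>p $ k = 0 < ps $ k\<close> for some \<open>k\<close>; use it for positive \<open>p\<close> only.\<close>

definition KL :: "real^'k \<Rightarrow> real^'k \<Rightarrow> real" where
  "KL ps p = (\<Sum>k\<in>UNIV. ps $ k * ln (ps $ k)) - (\<Sum>k\<in>UNIV. ps $ k * ln (p $ k))"

definition cond_sum_div :: "real^'m \<Rightarrow> real^'n \<Rightarrow> real^'n^'m \<Rightarrow> real^'n \<Rightarrow> real" where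
  "cond_sum_div xs ys X y = (\<Sum>j\<in>UNIV. KL xs (column j X)) + KL ys y"

definition cond_sum_div_dot ::
    "real^'n^'m \<Rightarrow> real^'m \<Rightarrow> real^'n \<Rightarrow> real^'n^'m \<Rightarrow> real^'n \<Rightarrow> real" where
  "cond_sum_div_dot U xs ys X y =
     (\<Sum>i\<in>UNIV. \<Sum>j\<in>UNIV.
        partial_mat (\<lambda>X'. cond_sum_div xs ys X' y) X i j * replicator_X U X y i j) +
     (\<Sum>j\<in>UNIV. partial_vec (\<lambda>y'. cond_sum_div xs ys X y') y j * replicator_Y U X y j)"

definition pos_def_zero_sum :: "real^'n^'n \<Rightarrow> bool" where
  "pos_def_zero_sum M \<longleftrightarrow>
     (\<forall>d. d \<noteq> 0 \<and> (\<Sum>k\<in>UNIV. d $ k) = 0 \<longrightarrow> 0 < d \<bullet> (M *v d))"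

end

theory Submission
  imports Defs
begin

text \<open>Write \<open>d = y - y*\<close>. The weights \<open>x*\<^sub>i / x\<^bsub>i|j\<^esub>\<close> and \<open>y*\<^sub>j / y\<^sub>j\<close> coming from the divergence cancel
  the prefactors of the replicator dynamics, so its time derivative is a polynomial, namely
  \<open>X y* \<cdot> U y* - x* \<cdot> U y - d \<cdot> X\<^sup>T U d\<close>. By the equilibrium property the value of the game separates
  the first two terms, and the last one is negative by definiteness, as \<open>d\<close> has zero sum.\<close>

lemma stationary_strategy_eq: "stationary_strategy X y = X *v y"
  by (simp add: stationary_strategy_def matrix_vector_mult_def)

lemma inner_transpose_mult:
  fixes A :: "real^'n^'m"
  shows "v \<bullet> (transpose A *v w) = (A *v v) \<bullet> w"
  by (metis dot_lmul_matrix inner_commute transpose_matrix_vector)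

text \<open>A convex combination of the columns of \<open>X\<close>. It makes \<open>X *v ys\<close>
  an admissible deviation from \<open>xs\<close> in the equilibrium condition.\<close>

lemma matrix_vector_mult_prob_simplex:
  assumes "reactive_strategy X" "y \<in> prob_simplex"
  shows "X *v y \<in> prob_simplex"
proof -
  have X: "0 \<le> X $ i $ j" "(\<Sum>i\<in>UNIV. X $ i $ j) = 1" for i j
    using assms(1) by (auto simp: reactive_strategy_def prob_simplex_def column_def)
  have "(\<Sum>i\<in>UNIV. (X *v y) $ i) = (\<Sum>j\<in>UNIV. (\<Sum>i\<in>UNIV. X $ i $ j) * y $ j)"
    unfolding matrix_vector_mult_def sum_distrib_right by (simp, rule sum.swap)
  then show ?thesis
    using assms(2) X by (auto simp: prob_simplex_def matrix_vector_mult_def intro!: sum_nonneg)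
qed

lemma grad_X_eq_vector: "grad_X U X y i j = y $ j * (U *v y) $ i"
  by (simp add: grad_X_eq matrix_vector_mult_def)

text \<open>Product rule for the payoff \<open>(X *v y) \<bullet> (U *v y)\<close>, differentiated
  in direction \<open>v\<close>. It serves for \<open>v = ys\<close> and for \<open>v = y\<close>,
  where it gives twice the payoff.\<close>

lemma sum_grad_Y:
  "(\<Sum>j\<in>UNIV. v $ j * grad_Y U X y j) = (X *v y) \<bullet> (U *v v) + (X *v v) \<bullet> (U *v y)"
proof -
  have "grad_Y U X y j = (transpose U *v (X *v y)) $ j + (transpose X *v (U *v y)) $ j" for j
    by (simp add: grad_Y_eq stationary_strategy_eq matrix_vector_mult_def transpose_def)
  then have "(\<Sum>j\<in>UNIV. v $ j * grad_Y U X y j) =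
      v \<bullet> (transpose U *v (X *v y)) + v \<bullet> (transpose X *v (U *v y))"
    by (simp add: inner_vec_def algebra_simps sum.distrib)
  then show ?thesis
    by (simp only: inner_transpose_mult inner_commute)
qed

lemma KL_has_derivative:
  assumes "\<forall>k. 0 < p $ k"
  shows "((\<lambda>t. KL ps (p + t *\<^sub>R v)) has_real_derivative - (\<Sum>k\<in>UNIV. ps $ k * v $ k / p $ k)) (at 0)"
  unfolding KL_def using assms
  by (auto intro!: derivative_eq_intros sum.cong simp: less_imp_neq[symmetric])

lemma partial_mat_cond_sum_div:
  assumes "\<forall>i j. 0 < X $ i $ j"
  shows "partial_mat (\<lambda>X'. cond_sum_div xs ys X' y) X i j = - xs $ i / X $ i $ j"
proof -
  \<comment> \<open>Only column \<open>j\<close> moves. The zero direction for the other columns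
    lets \<open>KL_has_derivative\<close> treat all columns alike.\<close>
  have col: "column k (X + t *\<^sub>R axis i (axis j 1)) =
      column k X + t *\<^sub>R (if k = j then axis i 1 else 0)" for k t
    by (auto simp: column_def vec_eq_iff axis_def)
  have "((\<lambda>t. cond_sum_div xs ys (X + t *\<^sub>R axis i (axis j 1)) y) has_real_derivative
      (\<Sum>k\<in>UNIV. - (\<Sum>l\<in>UNIV. xs $ l * (if k = j then axis i 1 else 0) $ l / column k X $ l)) + 0) (at 0)"
    unfolding cond_sum_div_def col
    using assms by (intro DERIV_add DERIV_sum KL_has_derivative DERIV_const) (simp add: column_def)
  \<comment> \<open>Both sums become nested conditionals. \<open>sum.delta\<close> is held back here
    so that the two sides keep the same shape; it collapses them in the last step.\<close>
  also have "(\<Sum>k\<in>UNIV. - (\<Sum>l\<in>UNIV. xs $ l * (if k = j then axis i 1 else 0) $ l / column k X $ l)) + 0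
      = (\<Sum>k\<in>UNIV. if k = j then - (\<Sum>l\<in>UNIV. if l = i then xs $ l / X $ l $ k else 0) else 0)"
    by (auto intro!: arg_cong2[where f = "(+)"] sum.cong simp: axis_def column_def simp del: sum.delta)
  finally show ?thesis
    unfolding partial_mat_def dir_deriv_def by (simp add: DERIV_imp_deriv)
qed

lemma partial_vec_cond_sum_div:
  assumes "\<forall>j. 0 < y $ j"
  shows "partial_vec (\<lambda>y'. cond_sum_div xs ys X y') y j = - ys $ j / y $ j"
proof -
  have "((\<lambda>t. cond_sum_div xs ys X (y + t *\<^sub>R axis j 1)) has_real_derivative
      0 + - (\<Sum>k\<in>UNIV. ys $ k * axis j 1 $ k / y $ k)) (at 0)"
    unfolding cond_sum_div_def
    using assms by (intro DERIV_add KL_has_derivative DERIV_const)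
  also have "(\<Sum>k\<in>UNIV. ys $ k * axis j 1 $ k / y $ k) = (\<Sum>k\<in>UNIV. if k = j then ys $ k / y $ k else 0)"
    by (intro sum.cong refl) (simp add: axis_def)
  finally show ?thesis
    unfolding partial_vec_def dir_deriv_def by (simp add: DERIV_imp_deriv)
qed

lemma cond_sum_div_dot_eq:
  assumes "xs \<in> prob_simplex" "ys \<in> prob_simplex" "y \<in> prob_simplex"
    and X: "\<forall>i j. 0 < X $ i $ j" and y: "\<forall>j. 0 < y $ j"
  shows "cond_sum_div_dot U xs ys X y = (X *v ys) \<bullet> (U *v ys) - xs \<bullet> (U *v y)
    - (y - ys) \<bullet> ((transpose X ** U) *v (y - ys))"
proof -
  have s: "(\<Sum>i\<in>UNIV. xs $ i) = 1" "(\<Sum>j\<in>UNIV. ys $ j) = 1" "(\<Sum>j\<in>UNIV. y $ j) = 1"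
    using assms by (auto simp: prob_simplex_def)
  define w where "w = U *v y"
  have "(\<Sum>i\<in>UNIV. \<Sum>j\<in>UNIV. - xs $ i / X $ i $ j * replicator_X U X y i j) =
      (\<Sum>i\<in>UNIV. \<Sum>j\<in>UNIV. xs $ i * (y $ j * (\<Sum>k\<in>UNIV. X $ k $ j * w $ k)) - (xs $ i * w $ i) * y $ j)"
    using X[rule_format, THEN less_imp_neq]
    by (intro sum.cong refl)
      (simp add: replicator_X_def grad_X_eq_vector w_def[symmetric] sum_distrib_left sum_negf algebra_simps)
  \<comment> \<open>In the first term \<open>i\<close> occurs only in \<open>xs $ i\<close>, in the
    second \<open>j\<close> only in \<open>y $ j\<close>; these weights sum to 1.\<close>
  also have "\<dots> = (\<Sum>j\<in>UNIV. y $ j * (\<Sum>k\<in>UNIV. X $ k $ j * w $ k)) - xs \<bullet> w"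
    by (simp add: sum_subtractf sum_distrib_left[symmetric] sum_distrib_right[symmetric] s inner_vec_def)
  also have "(\<Sum>j\<in>UNIV. y $ j * (\<Sum>k\<in>UNIV. X $ k $ j * w $ k)) = y \<bullet> (transpose X *v w)"
    by (simp add: inner_vec_def matrix_vector_mult_def transpose_def)
  also have "\<dots> = (X *v y) \<bullet> w"
    by (rule inner_transpose_mult)
  finally have X_part: "(\<Sum>i\<in>UNIV. \<Sum>j\<in>UNIV. - xs $ i / X $ i $ j * replicator_X U X y i j) =
      (X *v y) \<bullet> w - xs \<bullet> w" .
  define h where "h = grad_Y U X y"
  \<comment> \<open>The minus sign of the divergence meets that of the minimizing player, so
    \<open>h\<close> enters at \<open>ys\<close> with a plus sign.\<close>
  have "(\<Sum>j\<in>UNIV. - ys $ j / y $ j * replicator_Y U X y j) =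
      (\<Sum>j\<in>UNIV. ys $ j * h j - ys $ j * (\<Sum>k\<in>UNIV. y $ k * h k))"
    using y[rule_format, THEN less_imp_neq]
    by (intro sum.cong refl) (simp add: replicator_Y_def h_def algebra_simps)
  also have "\<dots> = (\<Sum>j\<in>UNIV. ys $ j * h j) - (\<Sum>j\<in>UNIV. y $ j * h j)"
    by (simp add: sum_subtractf sum_distrib_right[symmetric] s)
  finally have Y_part: "(\<Sum>j\<in>UNIV. - ys $ j / y $ j * replicator_Y U X y j) =
      (\<Sum>j\<in>UNIV. ys $ j * h j) - (\<Sum>j\<in>UNIV. y $ j * h j)" .
  \<comment> \<open>Since \<open>sum_grad_Y\<close> at \<open>y\<close> gives twice
    \<open>(X *v y) \<bullet> (U *v y)\<close>, one copy survives, negated, after adding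
    \<open>X_part\<close>. With the two mixed terms it completes to minus this form plus
    \<open>(X *v ys) \<bullet> (U *v ys)\<close>.\<close>
  have "(y - ys) \<bullet> ((transpose X ** U) *v (y - ys)) = (X *v (y - ys)) \<bullet> (U *v (y - ys))"
    by (simp add: matrix_vector_mul_assoc[symmetric] inner_transpose_mult del: transpose_matrix_vector)
  then show ?thesis
    unfolding cond_sum_div_dot_def partial_mat_cond_sum_div[OF X] partial_vec_cond_sum_div[OF y]
      X_part Y_part
    by (simp add: h_def w_def sum_grad_Y matrix_vector_mult_diff_distrib inner_diff_left inner_diff_right)
qed

theorem theorem1:
  fixes U X :: "real^'n^'m" and xs :: "real^'m" and ys :: "real^'n"
  assumes "nash_equilibrium U xs ys"
    and "reactive_strategy X"
    and "\<forall>i j. 0 < X $ i $ j"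
    and "pos_def_zero_sum (transpose X ** U)"
  shows "\<forall>y\<in>prob_simplex. (\<forall>j. 0 < y $ j) \<and> y - ys \<noteq> 0 \<longrightarrow> cond_sum_div_dot U xs ys X y < 0"
proof (intro ballI impI, elim conjE)
  fix y assume y: "y \<in> prob_simplex" "\<forall>j. 0 < y $ j" "y - ys \<noteq> 0"
  have simplex: "xs \<in> prob_simplex" "ys \<in> prob_simplex"
    using assms(1) by (auto simp: nash_equilibrium_def)
  \<comment> \<open>Two deviations are tested: \<open>X *v ys\<close> against \<open>ys\<close>, and
    \<open>y\<close> against \<open>xs\<close>.\<close>
  have "(X *v ys) \<bullet> (U *v ys) \<le> xs \<bullet> (U *v ys)" "xs \<bullet> (U *v ys) \<le> xs \<bullet> (U *v y)"
    using assms(1) y(1) matrix_vector_mult_prob_simplex[OF assms(2) simplex(2)]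
    by (auto simp: nash_equilibrium_def)
  moreover have "(\<Sum>j\<in>UNIV. (y - ys) $ j) = 0"
    using y(1) simplex(2) by (simp add: prob_simplex_def sum_subtractf)
  then have "0 < (y - ys) \<bullet> ((transpose X ** U) *v (y - ys))"
    using assms(4) y(3) unfolding pos_def_zero_sum_def by blast
  ultimately show "cond_sum_div_dot U xs ys X y < 0"
    unfolding cond_sum_div_dot_eq[OF simplex y(1) assms(3) y(2)] by linarith
qed

end
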